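(* Let $(P_0,f_0)\in\mathcal{R}$, let $x_0\in\mathbb{R}$, let $\vec{x}:R(P_0)\ominus\langle f_0\rangle\to\langle f_0\rangle$ and $A:N(P_0)\to R(P_0)$ be bounded operators. There exists an anti-Hermitian operator $Y_0$ in $R(P_0)\ominus\langle f_0\rangle$ such that $$\left\|\begin{pmatrix} \begin{matrix} i x_0 & \vec{x}\\ -\vec{\bar{x}}^t & Y_0\end{matrix} & A\end{pmatrix}\right\|\le\left\|\begin{pmatrix} \begin{matrix} i x_0 & \vec{x}\\ -\vec{\bar{x}}^t & Y\end{matrix} & A\end{pmatrix}\right\|$$ for any other anti-Hermitian operator $Y$ in $R(P_0)\ominus\langle f_0\rangle$.
   Context: $\mathcal{H}$ is a complex Hilbert space and $\mathcal{R}=\{(P,f): P \text{ an orthogonal projection on } \mathcal{H},\ f\in\mathcal{H},\ Pf=f,\ \|f\|=1\}$. $R(P_0)$ and $N(P_0)$ are the range and nullspace of $P_0$, $\langle f_0\rangle$ is the line spanned by $f_0$, and $R(P_0)\ominus\langle f_0\rangle$ its orthogonal complement in $R(P_0)$. The displayed rows are operators from $R(P_0)\oplus N(P_0)$ to $R(P_0)$, with the $2\times 2$ block written with respect to $R(P_0)=\langle f_0\rangle\oplus(R(P_0)\ominus\langle f_0\rangle)$; $\vec{\bar{x}}^t$ denotes the adjoint of $\vec{x}$. Norms are operator norms. *)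

theory Defs
  imports "HOL-Analysis.Analysis"
begin

section \<open>Complex Hilbert spaces\<close>

text \<open>
  The underlying real inner product is required to be the real part of the complex one, so that
  the norm, the topology and completeness of the library are those of the complex Hilbert space.
  The inner product is linear in the first argument.
\<close>

class chilbert_space = real_inner + complete_space +
  fixes scaleC :: "complex \<Rightarrow> 'a \<Rightarrow> 'a" (infixr "*\<^sub>C" 75)
    and cinner :: "'a \<Rightarrow> 'a \<Rightarrow> complex"
  assumes scaleR_scaleC: "r *\<^sub>R x = complex_of_real r *\<^sub>C x"
    and scaleC_add_right: "c *\<^sub>C (x + y) = c *\<^sub>C x + c *\<^sub>C y"
    and scaleC_add_left: "(c + d) *\<^sub>C x = c *\<^sub>C x + d *\<^sub>C x"
    and scaleC_scaleC: "c *\<^sub>C d *\<^sub>C x = (c * d) *\<^sub>C x"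
    and cinner_commute: "cinner x y = cnj (cinner y x)"
    and cinner_add_left: "cinner (x + y) z = cinner x z + cinner y z"
    and cinner_scaleC_left: "cinner (c *\<^sub>C x) y = c * cinner x y"
    and inner_eq_Re_cinner: "inner x y = Re (cinner x y)"

instantiation complex :: chilbert_space
begin

definition scaleC_complex :: "complex \<Rightarrow> complex \<Rightarrow> complex"
  where "scaleC_complex c x = c * x"

definition cinner_complex :: "complex \<Rightarrow> complex \<Rightarrow> complex"
  where "cinner_complex x y = x * cnj y"

instance
  by standard
    (simp_all add: scaleC_complex_def cinner_complex_def scaleR_conv_of_real algebra_simps
      inner_complex_def)

end

definition csubspace :: "'a::chilbert_space set \<Rightarrow> bool"
  where "csubspace S \<longleftrightarrow>
    0 \<in> S \<and> (\<forall>x\<in>S. \<forall>y\<in>S. x + y \<in> S) \<and> (\<forall>c. \<forall>x\<in>S. c *\<^sub>C x \<in> S)"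

definition cline :: "'a::chilbert_space \<Rightarrow> 'a set"
  where "cline f = range (\<lambda>c. c *\<^sub>C f)"

definition nullspace :: "('a::chilbert_space \<Rightarrow> 'a) \<Rightarrow> 'a set"
  where "nullspace P = {x. P x = 0}"

definition ortho_minus :: "'a::chilbert_space set \<Rightarrow> 'a set \<Rightarrow> 'a set"  (infixl "\<ominus>" 65)
  where "S \<ominus> T = {x\<in>S. \<forall>y\<in>T. cinner x y = 0}"

section \<open>Operators between subspaces\<close>

text \<open>
  An operator from a subspace \<open>S\<close> to a subspace \<open>T\<close> is represented by a function on the whole
  space of which only the values on \<open>S\<close> matter.
\<close>

definition bounded_op ::
    "'a::chilbert_space set \<Rightarrow> 'a set \<Rightarrow> ('a \<Rightarrow> 'a) \<Rightarrow> bool"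
  where "bounded_op S T f \<longleftrightarrow>
    (\<forall>x\<in>S. f x \<in> T) \<and>
    (\<forall>x\<in>S. \<forall>y\<in>S. f (x + y) = f x + f y) \<and>
    (\<forall>c. \<forall>x\<in>S. f (c *\<^sub>C x) = c *\<^sub>C f x) \<and>
    (\<exists>K. \<forall>x\<in>S. norm (f x) \<le> K * norm x)"

text \<open>
  The adjoint of an operator with domain \<open>S\<close>; it takes values in \<open>S\<close>. See \<open>adjoint_on\<close> below for
  the fact that the description is proper when \<open>S\<close> is a closed subspace.
\<close>

definition adjoint_on :: "'a::chilbert_space set \<Rightarrow> ('a \<Rightarrow> 'a) \<Rightarrow> 'a \<Rightarrow> 'a"
  where "adjoint_on S f v = (THE u. u \<in> S \<and> (\<forall>w\<in>S. cinner (f w) v = cinner w u))"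

definition antihermitian_on :: "'a::chilbert_space set \<Rightarrow> ('a \<Rightarrow> 'a) \<Rightarrow> bool"
  where "antihermitian_on S Y \<longleftrightarrow>
    bounded_op S S Y \<and> (\<forall>u\<in>S. adjoint_on S Y u = - Y u)"

definition orthogonal_projection :: "('a::chilbert_space \<Rightarrow> 'a) \<Rightarrow> bool"
  where "orthogonal_projection P \<longleftrightarrow>
    bounded_op UNIV UNIV P \<and> P \<circ> P = P \<and> adjoint_on UNIV P = P"

definition proj_vec_pairs :: "(('a::chilbert_space \<Rightarrow> 'a) \<times> 'a) set"
  where "proj_vec_pairs = {(P, f). orthogonal_projection P \<and> P f = f \<and> norm f = 1}"

text \<open>
  The row operator with blocks \<open>i x0\<close>, \<open>x\<close>, \<open>- x\<^sup>*\<close>, \<open>Y\<close>, \<open>A\<close>. Its argument \<open>h\<close> is split as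
  \<open>h = a + b + n\<close> with \<open>a\<close> in the line spanned by \<open>f\<close>, \<open>b\<close> in the orthogonal complement of that
  line in the range of \<open>P\<close>, and \<open>n\<close> in the nullspace of \<open>P\<close>. As the orthogonal sum of the range
  and the nullspace is the whole space, its operator norm is \<open>onorm\<close>.
\<close>

definition row_operator ::
    "('a::chilbert_space \<Rightarrow> 'a) \<Rightarrow> 'a \<Rightarrow> real \<Rightarrow> ('a \<Rightarrow> 'a) \<Rightarrow> ('a \<Rightarrow> 'a) \<Rightarrow> ('a \<Rightarrow> 'a) \<Rightarrow> 'a \<Rightarrow> 'a"
  where "row_operator P f x0 x Y A h =
    (let a = cinner (P h) f *\<^sub>C f;
         b = P h - a;
         n = h - P h
     in ((\<i> * complex_of_real x0) *\<^sub>C a + x b)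
        + (- adjoint_on (range P \<ominus> cline f) x a + Y b)
        + A n)"

section \<open>The adjoint is well defined\<close>

lemma cinner_add_right: "cinner x (y + z) = cinner x y + cinner x z"
  for x :: "'a::chilbert_space"
  by (metis cinner_add_left cinner_commute complex_cnj_add)

lemma cinner_scaleC_right: "cinner x (c *\<^sub>C y) = cnj c * cinner x y"
  for x :: "'a::chilbert_space"
  by (metis cinner_commute cinner_scaleC_left complex_cnj_mult)

lemma inner_ii_left: "inner (\<i> *\<^sub>C x) y = - Im (cinner x y)"
  for x :: "'a::chilbert_space"
  by (simp add: inner_eq_Re_cinner cinner_scaleC_left)

lemma csubspaceD:
  assumes "csubspace S"
  shows "0 \<in> S" "x \<in> S \<Longrightarrow> y \<in> S \<Longrightarrow> x + y \<in> S" "x \<in> S \<Longrightarrow> c *\<^sub>C x \<in> S"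
    "x \<in> S \<Longrightarrow> r *\<^sub>R x \<in> S"
  using assms by (auto simp: csubspace_def scaleR_scaleC)

lemma adjoint_exists:
  fixes f :: "'a::chilbert_space \<Rightarrow> 'a"
  assumes S: "csubspace S" "closed S" and f: "bounded_op S T f"
  shows "\<exists>u\<in>S. \<forall>w\<in>S. cinner (f w) v = cinner w u"
proof -
  note SD = csubspaceD[OF S(1)]
  define g where "g w = inner (f w) v" for w
  have gadd: "g (a + b) = g a + g b" if "a \<in> S" "b \<in> S" for a b
    using f that by (simp add: g_def bounded_op_def inner_add_left)
  have gscale: "g (r *\<^sub>R a) = r * g a" if "a \<in> S" for r a
    using f that by (simp add: g_def bounded_op_def scaleR_scaleC[of r a])
      (simp flip: scaleR_scaleC)
  obtain K where K: "norm (f w) \<le> K * norm w" if "w \<in> S" for w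
    using f unfolding bounded_op_def by blast
  define J where "J w = inner w w - 2 * g w" for w
  have Jlow: "J w \<ge> - (K * norm v)\<^sup>2" if "w \<in> S" for w
  proof -
    have "g w \<le> norm (f w) * norm v" by (simp add: g_def norm_cauchy_schwarz)
    also have "\<dots> \<le> K * norm w * norm v" by (intro mult_right_mono K that) simp
    finally have "g w \<le> norm w * (K * norm v)" by (simp add: mult_ac)
    moreover have "0 \<le> (norm w - K * norm v)\<^sup>2" by simp
    ultimately show ?thesis
      unfolding J_def power2_norm_eq_inner[symmetric] by (simp add: power2_diff)
  qed
  define m where "m = Inf (J ` S)"
  have bdd: "bdd_below (J ` S)" using Jlow by (intro bdd_belowI2) auto
  have m_le: "m \<le> J w" if "w \<in> S" for w
    unfolding m_def using bdd that by (simp add: cINF_lower)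
  have "\<exists>w\<in>S. J w < m + 1 / real (Suc n)" for n
  proof -
    have "J ` S \<noteq> {}" using SD(1) by auto
    moreover have "Inf (J ` S) < m + 1 / real (Suc n)" by (simp add: m_def)
    ultimately show ?thesis using bdd by (subst (asm) cInf_less_iff) auto
  qed
  then obtain s where s: "\<And>n. s n \<in> S" "\<And>n. J (s n) < m + 1 / real (Suc n)" by metis
  have dist_s: "(norm (s i - s j))\<^sup>2 \<le> 2 / real (Suc i) + 2 / real (Suc j)" for i j
  proof -
    let ?h = "(1/2::real) *\<^sub>R (s i + s j)"
    have "m \<le> J ?h" by (intro m_le SD s)
    moreover have "(norm (s i - s j))\<^sup>2 = 2 * J (s i) + 2 * J (s j) - 4 * J ?h"
      using s(1) by (simp add: J_def gscale gadd SD power2_norm_eq_inner inner_diff_left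
          inner_diff_right inner_add_left inner_add_right inner_commute algebra_simps)
    ultimately show ?thesis using s(2)[of i] s(2)[of j] by simp
  qed
  have "Cauchy s"
  proof (rule metric_CauchyI)
    fix e :: real assume "0 < e"
    then obtain N where N: "1 / real (Suc N) < e\<^sup>2 / 4"
      using nat_approx_posE[of "e\<^sup>2 / 4"] by auto
    have "dist (s i) (s j) < e" if "i \<ge> N" "j \<ge> N" for i j
    proof -
      have "1 / real (Suc i) \<le> 1 / real (Suc N)" "1 / real (Suc j) \<le> 1 / real (Suc N)"
        using that by (auto simp: field_simps)
      then have "(norm (s i - s j))\<^sup>2 < e\<^sup>2" using dist_s[of i j] N by simp
      then show ?thesis using \<open>0 < e\<close> by (simp add: dist_norm power2_less_imp_less)
    qed
    then show "\<exists>M. \<forall>i\<ge>M. \<forall>j\<ge>M. dist (s i) (s j) < e" by blast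
  qed
  then obtain u where u: "s \<longlonglongrightarrow> u"
    by (auto simp: Cauchy_convergent_iff convergent_def)
  have uS: "u \<in> S" using S(2) s(1) u closed_sequentially by blast
  have quad: "0 \<le> 2 * t * (inner u w - g w) + t\<^sup>2 * inner w w" if w: "w \<in> S" for t w
  proof (rule LIMSEQ_le)
    show "(\<lambda>n. - (1 / real (Suc n))) \<longlonglongrightarrow> 0"
      using tendsto_minus[OF LIMSEQ_inverse_real_of_nat] by (simp add: inverse_eq_divide)
    show "(\<lambda>n. 2 * t * (inner (s n) w - g w) + t\<^sup>2 * inner w w)
        \<longlonglongrightarrow> 2 * t * (inner u w - g w) + t\<^sup>2 * inner w w"
      by (intro tendsto_intros u)
    have "- (1 / real (Suc n)) \<le> 2 * t * (inner (s n) w - g w) + t\<^sup>2 * inner w w" for n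
    proof -
      have "m \<le> J (s n + t *\<^sub>R w)" by (intro m_le SD s w)
      also have "\<dots> = J (s n) + (2 * t * (inner (s n) w - g w) + t\<^sup>2 * inner w w)"
        using s(1) w by (simp add: J_def gscale gadd SD inner_add_left inner_add_right
            inner_commute algebra_simps power2_eq_square)
      finally show ?thesis using s(2)[of n] by simp
    qed
    then show "\<exists>N. \<forall>n\<ge>N. - (1 / real (Suc n))
        \<le> 2 * t * (inner (s n) w - g w) + t\<^sup>2 * inner w w" by blast
  qed
  have real_eq: "g w = inner w u" if w: "w \<in> S" for w
  proof (rule ccontr)
    assume "g w \<noteq> inner w u"
    define d where "d = inner u w - g w"
    have d: "d \<noteq> 0" using \<open>g w \<noteq> inner w u\<close> by (simp add: d_def inner_commute)
    define q where "q = inner w w + 1"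
    have q: "q > 0" "inner w w < q" by (simp_all add: q_def add_nonneg_pos)
    have "0 \<le> 2 * (- d / q) * d + (- d / q)\<^sup>2 * inner w w"
      using quad[OF w, of "- d / q"] by (simp add: d_def)
    also have "\<dots> \<le> 2 * (- d / q) * d + (- d / q)\<^sup>2 * q"
      using q by (intro add_left_mono mult_left_mono) auto
    also have "\<dots> = - (d\<^sup>2 / q)"
      using q by (simp add: field_simps power2_eq_square)
    also have "\<dots> < 0" using d q by simp
    finally show False by simp
  qed
  have "cinner (f w) v = cinner w u" if w: "w \<in> S" for w
  proof (rule complex_eqI)
    show "Re (cinner (f w) v) = Re (cinner w u)"
      using real_eq[OF w] by (simp add: g_def inner_eq_Re_cinner)
    have "f (\<i> *\<^sub>C w) = \<i> *\<^sub>C f w" using f w by (simp add: bounded_op_def)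
    then show "Im (cinner (f w) v) = Im (cinner w u)"
      using real_eq[OF SD(3)[OF w, of \<i>]] by (simp add: g_def inner_ii_left)
  qed
  then show ?thesis using uS by blast
qed

lemma adjoint_unique:
  fixes u u' :: "'a::chilbert_space"
  assumes S: "csubspace S" and "u \<in> S" "u' \<in> S" "\<And>w. w \<in> S \<Longrightarrow> cinner w u = cinner w u'"
  shows "u = u'"
proof -
  have "u - u' = u + (- 1 :: real) *\<^sub>R u'" by simp
  then have "u - u' \<in> S" using csubspaceD[OF S] assms by metis
  then have "inner (u - u') u = inner (u - u') u'"
    using assms(4) by (simp add: inner_eq_Re_cinner)
  then have "inner (u - u') (u - u') = 0" by (simp only: inner_diff_right)
  then show ?thesis by simp
qed

lemma adjoint_on:
  fixes f :: "'a::chilbert_space \<Rightarrow> 'a"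
  assumes "csubspace S" "closed S" "bounded_op S T f"
  shows "adjoint_on S f v \<in> S"
    and "w \<in> S \<Longrightarrow> cinner (f w) v = cinner w (adjoint_on S f v)"
proof -
  have "\<exists>!u. u \<in> S \<and> (\<forall>w\<in>S. cinner (f w) v = cinner w u)"
    using adjoint_exists[OF assms] adjoint_unique[OF assms(1)] by (metis (no_types, lifting))
  from theI'[OF this] show "adjoint_on S f v \<in> S"
    and "w \<in> S \<Longrightarrow> cinner (f w) v = cinner w (adjoint_on S f v)"
    by (auto simp: adjoint_on_def)
qed

end

theory Submission
  imports Defs
begin

text \<open>
  The row operator is \<open>h \<mapsto> R h + Y (B h)\<close>, where \<open>R\<close> is the row with \<open>Y\<close> replaced by zero and
  \<open>B\<close> is the orthogonal projection onto \<open>S = R(P0) \<ominus> \<langle>f0\<rangle>\<close>. So the task is to minimise a norm over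
  an affine family of operators, and the minimum is attained by weak compactness.

  A minimising sequence of anti-Hermitian operators \<open>Y\<^sub>n\<close> is bounded in norm, because \<open>Y\<^sub>n\<close> is
  the restriction of \<open>R + Y\<^sub>n B\<close> to \<open>S\<close> minus that of \<open>R\<close>. Its matrix coefficients
  \<open>\<langle>u, Y\<^sub>n v\<rangle>\<close> therefore lie in fixed discs, and by Tychonoff's theorem they all converge along
  one common filter finer than the sequential one (\<open>bounded_family_cluster_point\<close>). The limits form
  a bounded sesquilinear form, which the Riesz representation theorem turns into an operator \<open>Y0\<close>
  (\<open>bounded_ops_weak_cluster_point\<close>). Anti-Hermiticity is an identity between matrix coefficients,
  so it passes to \<open>Y0\<close>, and the operator norm is weakly lower semicontinuous, so \<open>Y0\<close> attains
  the infimum (\<open>antihermitian_perturbation_minimizer\<close>).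
\<close>

section \<open>The complex inner product\<close>

lemma cinner_zero_left [simp]: "cinner 0 y = 0"
  for y :: "'a::chilbert_space"
  using cinner_add_left[of 0 0 y] by simp

lemma cinner_zero_right [simp]: "cinner x 0 = 0"
  for x :: "'a::chilbert_space"
  using cinner_add_right[of x 0 0] by simp

lemma cinner_minus_left [simp]: "cinner (- x) y = - cinner x y"
  for x :: "'a::chilbert_space"
  using cinner_add_left[of "- x" x y] by (simp add: eq_neg_iff_add_eq_0)

lemma cinner_minus_right [simp]: "cinner x (- y) = - cinner x y"
  for x :: "'a::chilbert_space"
  using cinner_add_right[of x "- y" y] by (simp add: eq_neg_iff_add_eq_0)

lemma cinner_diff_left: "cinner (x - y) z = cinner x z - cinner y z"
  for x :: "'a::chilbert_space"
  using cinner_add_left[of x "- y" z] by simp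

lemma scaleC_zero_left [simp]: "0 *\<^sub>C x = 0"
  for x :: "'a::chilbert_space"
  using scaleC_add_left[of 0 0 x] by simp

lemma scaleC_zero_right [simp]: "c *\<^sub>C (0 :: 'a::chilbert_space) = 0"
  using scaleC_add_right[of c 0 0] by simp

lemma scaleC_one [simp]: "1 *\<^sub>C x = x"
  for x :: "'a::chilbert_space"
  using scaleR_scaleC[of 1 x] by simp

lemma cinner_self: "cinner x x = complex_of_real ((norm x)\<^sup>2)"
  for x :: "'a::chilbert_space"
proof (rule complex_eqI)
  show "Re (cinner x x) = Re (complex_of_real ((norm x)\<^sup>2))"
    by (simp add: power2_norm_eq_inner inner_eq_Re_cinner)
  have "Im (cinner x x) = - Im (cinner x x)"
    using arg_cong[OF cinner_commute[of x x], of Im] by simp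
  then show "Im (cinner x x) = Im (complex_of_real ((norm x)\<^sup>2))" by simp
qed

lemma norm_scaleC: "norm (c *\<^sub>C x) = cmod c * norm x"
  for x :: "'a::chilbert_space"
proof -
  have "complex_of_real ((norm (c *\<^sub>C x))\<^sup>2) = (c * cnj c) * cinner x x"
    by (simp only: cinner_self[symmetric] cinner_scaleC_left cinner_scaleC_right)
      (simp add: mult_ac)
  also have "\<dots> = complex_of_real ((cmod c * norm x)\<^sup>2)"
    by (simp only: complex_norm_square[symmetric] cinner_self power_mult_distrib of_real_mult)
  finally have "(norm (c *\<^sub>C x))\<^sup>2 = (cmod c * norm x)\<^sup>2"
    by (simp only: of_real_eq_iff)
  then show ?thesis by (simp add: power2_eq_iff_nonneg)
qed

lemma norm_cinner_le: "cmod (cinner x y) \<le> norm x * norm y"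
  for x :: "'a::chilbert_space"
proof (cases "cinner x y = 0")
  case False
  \<comment> \<open>Rotating the first argument by a unit scalar makes the inner product real and nonnegative,
    so that the Cauchy-Schwarz inequality of the real inner product applies.\<close>
  define c where "c = cnj (cinner x y) / cmod (cinner x y)"
  have "cinner (c *\<^sub>C x) y = (cmod (cinner x y))\<^sup>2 / cmod (cinner x y)"
    by (simp only: c_def cinner_scaleC_left of_real_divide complex_norm_square
        times_divide_eq_left times_divide_eq_right mult.commute)
  then have "cinner (c *\<^sub>C x) y = cmod (cinner x y)"
    by (simp add: power2_eq_square)
  then have "cmod (cinner x y) = inner (c *\<^sub>C x) y" by (simp add: inner_eq_Re_cinner)
  also have "\<dots> \<le> norm (c *\<^sub>C x) * norm y" by (rule norm_cauchy_schwarz)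
  also have "\<dots> = norm x * norm y"
    using False by (simp add: norm_scaleC c_def norm_divide)
  finally show ?thesis .
qed simp

section \<open>Bounded operators between subspaces\<close>

lemma bounded_opI:
  assumes "\<And>x. x \<in> S \<Longrightarrow> f x \<in> T"
    and "\<And>x y. x \<in> S \<Longrightarrow> y \<in> S \<Longrightarrow> f (x + y) = f x + f y"
    and "\<And>c x. x \<in> S \<Longrightarrow> f (c *\<^sub>C x) = c *\<^sub>C f x"
    and "\<And>x. x \<in> S \<Longrightarrow> norm (f x) \<le> K * norm x"
  shows "bounded_op S T f"
  using assms unfolding bounded_op_def by blast

lemma bounded_opD:
  assumes "bounded_op S T f"
  shows "x \<in> S \<Longrightarrow> f x \<in> T"
    and "x \<in> S \<Longrightarrow> y \<in> S \<Longrightarrow> f (x + y) = f x + f y"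
    and "x \<in> S \<Longrightarrow> f (c *\<^sub>C x) = c *\<^sub>C f x"
  using assms unfolding bounded_op_def by blast+

lemma bounded_op_bound:
  assumes "bounded_op S T f"
  shows "\<exists>K\<ge>0. \<forall>x\<in>S. norm (f x) \<le> K * norm x"
proof -
  obtain K where K: "\<And>x. x \<in> S \<Longrightarrow> norm (f x) \<le> K * norm x"
    using assms unfolding bounded_op_def by blast
  have "norm (f x) \<le> max K 0 * norm x" if "x \<in> S" for x
    using K[OF that] mult_right_mono[OF max.cobounded1[of K 0] norm_ge_zero[of x]] by linarith
  then show ?thesis by (intro exI[of _ "max K 0"]) simp
qed

lemma bounded_op_zero: "0 \<in> T \<Longrightarrow> bounded_op S T (\<lambda>_. 0)"
  by (rule bounded_opI[where K = 0]) auto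

lemma bounded_op_ident: "bounded_op S S (\<lambda>x. x)"
  by (rule bounded_opI[where K = 1]) auto

lemma bounded_op_mono: "bounded_op S T f \<Longrightarrow> T \<subseteq> U \<Longrightarrow> bounded_op S U f"
  unfolding bounded_op_def by blast

lemma bounded_op_compose:
  assumes "bounded_op S T f" "bounded_op T U g"
  shows "bounded_op S U (\<lambda>x. g (f x))"
proof -
  obtain K L where K: "\<And>x. x \<in> S \<Longrightarrow> norm (f x) \<le> K * norm x"
    and L: "L \<ge> 0" "\<And>x. x \<in> T \<Longrightarrow> norm (g x) \<le> L * norm x"
    using bounded_op_bound[OF assms(1)] bounded_op_bound[OF assms(2)] by blast
  show ?thesis
  proof (rule bounded_opI)
    fix x assume x: "x \<in> S"
    have "norm (g (f x)) \<le> L * norm (f x)"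
      using x by (intro L bounded_opD(1)[OF assms(1)])
    also have "\<dots> \<le> L * (K * norm x)"
      using x by (intro mult_left_mono K L(1))
    finally show "norm (g (f x)) \<le> (L * K) * norm x" by (simp add: mult_ac)
  qed (simp_all add: bounded_opD[OF assms(1)] bounded_opD[OF assms(2)])
qed

lemma bounded_op_add:
  assumes "bounded_op S UNIV f" "bounded_op S UNIV g"
  shows "bounded_op S UNIV (\<lambda>x. f x + g x)"
proof -
  obtain K L where "\<And>x. x \<in> S \<Longrightarrow> norm (f x) \<le> K * norm x"
    and "\<And>x. x \<in> S \<Longrightarrow> norm (g x) \<le> L * norm x"
    using bounded_op_bound[OF assms(1)] bounded_op_bound[OF assms(2)] by blast
  then have "norm (f x + g x) \<le> (K + L) * norm x" if "x \<in> S" for x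
    using that by (intro norm_triangle_le) (simp add: distrib_right add_mono)
  then show ?thesis
    by (intro bounded_opI)
      (simp_all add: bounded_opD[OF assms(1)] bounded_opD[OF assms(2)] scaleC_add_right)
qed

lemma bounded_op_scaleC:
  assumes "bounded_op S UNIV f"
  shows "bounded_op S UNIV (\<lambda>x. c *\<^sub>C f x)"
proof -
  obtain K where "\<And>x. x \<in> S \<Longrightarrow> norm (f x) \<le> K * norm x"
    using bounded_op_bound[OF assms] by blast
  then have "norm (c *\<^sub>C f x) \<le> (cmod c * K) * norm x" if "x \<in> S" for x
    using that by (simp add: norm_scaleC mult.assoc mult_left_mono)
  then show ?thesis
    by (intro bounded_opI[where K = "cmod c * K"])
      (simp_all add: bounded_opD[OF assms] scaleC_add_right scaleC_scaleC mult_ac)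
qed

lemma bounded_op_minus:
  assumes "bounded_op S UNIV f"
  shows "bounded_op S UNIV (\<lambda>x. - f x)"
proof -
  have "- f x = (- 1) *\<^sub>C f x" for x
    using scaleR_scaleC[of "-1" "f x"] by simp
  then show ?thesis using bounded_op_scaleC[OF assms, of "- 1"] by simp
qed

lemma bounded_op_diff:
  assumes "bounded_op S UNIV f" "bounded_op S UNIV g"
  shows "bounded_op S UNIV (\<lambda>x. f x - g x)"
  using bounded_op_add[OF assms(1) bounded_op_minus[OF assms(2)]] by simp

lemma bounded_op_imp_bounded_linear: "bounded_op UNIV UNIV f \<Longrightarrow> bounded_linear f"
proof -
  assume f: "bounded_op UNIV UNIV f"
  then obtain K where "\<And>x. norm (f x) \<le> K * norm x"
    using bounded_op_bound[OF f] by blast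
  then show "bounded_linear f"
    by (intro bounded_linear_intro[where K = K])
      (simp_all add: bounded_opD[OF f] scaleR_scaleC mult.commute)
qed

lemma bounded_op_cinner_scaleC: "bounded_op UNIV UNIV (\<lambda>x. cinner x e *\<^sub>C f)"
proof (rule bounded_opI[where K = "norm e * norm f"])
  show "norm (cinner x e *\<^sub>C f) \<le> norm e * norm f * norm x" for x
    using mult_right_mono[OF norm_cinner_le[of x e], of "norm f"]
    by (simp add: norm_scaleC mult_ac)
qed (simp_all add: cinner_add_left cinner_scaleC_left scaleC_add_left scaleC_scaleC)

text \<open>
  Both linearity and the bound follow from the defining identity by testing it against vectors
  of the domain.
\<close>

lemma bounded_op_adjoint_on:
  fixes f :: "'a::chilbert_space \<Rightarrow> 'a"
  assumes S: "csubspace S" "closed S" and f: "bounded_op S T f"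
  shows "bounded_op UNIV S (adjoint_on S f)"
proof -
  note adj = adjoint_on[OF S f]
  obtain K where K: "K \<ge> 0" "\<And>x. x \<in> S \<Longrightarrow> norm (f x) \<le> K * norm x"
    using bounded_op_bound[OF f] by blast
  show ?thesis
  proof (rule bounded_opI)
    fix u v :: 'a and c :: complex
    show "adjoint_on S f u \<in> S" by (rule adj)
    show "adjoint_on S f (u + v) = adjoint_on S f u + adjoint_on S f v"
      by (rule adjoint_unique[OF S(1)])
        (simp_all add: adj csubspaceD[OF S(1)] cinner_add_right flip: adj(2))
    show "adjoint_on S f (c *\<^sub>C u) = c *\<^sub>C adjoint_on S f u"
      by (rule adjoint_unique[OF S(1)])
        (simp_all add: adj csubspaceD[OF S(1)] cinner_scaleC_right flip: adj(2))
    let ?w = "adjoint_on S f u"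
    have "norm ?w * norm ?w = cmod (cinner ?w ?w)"
      by (simp add: cinner_self norm_power power2_eq_square norm_mult)
    also have "\<dots> = cmod (cinner (f ?w) u)" by (simp add: adj)
    also have "\<dots> \<le> norm (f ?w) * norm u" by (rule norm_cinner_le)
    also have "\<dots> \<le> (K * norm ?w) * norm u"
      by (intro mult_right_mono K(2) adj) simp
    finally have "norm ?w * norm ?w \<le> norm ?w * (K * norm u)" by (simp add: mult_ac)
    then show "norm ?w \<le> K * norm u"
      using K(1) by (cases "norm ?w = 0") (auto simp: mult_le_cancel_left)
  qed
qed

text \<open>
  In this form the condition only speaks of matrix coefficients, hence it is stable under weak
  limits.
\<close>

lemma antihermitian_on_iff:
  assumes S: "csubspace S" "closed S"
  shows "antihermitian_on S Y \<longleftrightarrow>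
    bounded_op S S Y \<and> (\<forall>u\<in>S. \<forall>v\<in>S. cinner (Y u) v = - cinner u (Y v))"
proof (cases "bounded_op S S Y")
  case True
  note adj = adjoint_on[OF S True]
  have neg: "- Y u \<in> S" if "u \<in> S" for u
    using csubspaceD(4)[OF S(1) bounded_opD(1)[OF True that], of "- 1"] by simp
  have "adjoint_on S Y v = - Y v \<longleftrightarrow> (\<forall>u\<in>S. cinner (Y u) v = - cinner u (Y v))"
    if "v \<in> S" for v
  proof
    assume "adjoint_on S Y v = - Y v"
    then show "\<forall>u\<in>S. cinner (Y u) v = - cinner u (Y v)" by (simp add: adj)
  next
    assume "\<forall>u\<in>S. cinner (Y u) v = - cinner u (Y v)"
    then show "adjoint_on S Y v = - Y v"
      by (intro adjoint_unique[OF S(1)]) (simp_all add: adj neg that flip: adj(2))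
  qed
  then show ?thesis using True unfolding antihermitian_on_def by blast
qed (simp add: antihermitian_on_def)

section \<open>Weak compactness\<close>

text \<open>
  The adjoint of the rank-one operator \<open>w \<mapsto> \<phi> w e\<close>, for a nonzero vector \<open>e\<close>, takes a multiple
  of \<open>e\<close> to the representing vector.
\<close>

lemma Riesz_representation:
  fixes \<phi> :: "'a::chilbert_space \<Rightarrow> complex"
  assumes S: "csubspace S" "closed S"
    and add: "\<And>u v. u \<in> S \<Longrightarrow> v \<in> S \<Longrightarrow> \<phi> (u + v) = \<phi> u + \<phi> v"
    and scale: "\<And>c u. u \<in> S \<Longrightarrow> \<phi> (c *\<^sub>C u) = c * \<phi> u"
    and bound: "\<And>u. u \<in> S \<Longrightarrow> cmod (\<phi> u) \<le> K * norm u"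
  shows "\<exists>z\<in>S. \<forall>u\<in>S. \<phi> u = cinner u z"
proof (cases "\<exists>e::'a. e \<noteq> 0")
  case True
  then obtain e :: 'a where "e \<noteq> 0" by blast
  define e' where "e' = complex_of_real (1 / (norm e)\<^sup>2) *\<^sub>C e"
  have e': "cinner e e' = 1"
    using \<open>e \<noteq> 0\<close> by (simp add: e'_def cinner_scaleC_right cinner_self)
  have "bounded_op S UNIV (\<lambda>u. \<phi> u *\<^sub>C e)"
  proof (rule bounded_opI[where K = "K * norm e"])
    show "norm (\<phi> u *\<^sub>C e) \<le> K * norm e * norm u" if "u \<in> S" for u
      using mult_right_mono[OF bound[OF that], of "norm e"] by (simp add: norm_scaleC mult_ac)
  qed (simp_all add: add scale scaleC_add_left scaleC_scaleC)
  from adjoint_exists[OF S this, of e'] show ?thesis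
    by (simp only: cinner_scaleC_left e' mult_1_right)
next
  case False
  then have zero: "u = 0" for u :: 'a by simp
  have "\<phi> u = cinner u 0" if "u \<in> S" for u
    using scale[OF that, of 0] zero[of u] by simp
  then show ?thesis using csubspaceD(1)[OF S(1)] by blast
qed

text \<open>
  By Tychonoff's theorem the sequence has a cluster point in the product of the discs. The index
  set may be uncountable, so a subsequence need not converge in all coordinates and a filter takes
  its place.
\<close>

lemma bounded_family_cluster_point:
  fixes F :: "nat \<Rightarrow> 'i \<Rightarrow> complex"
  assumes "\<And>n i. cmod (F n i) \<le> c i"
  obtains G L where "G \<noteq> bot" "G \<le> sequentially" "\<forall>i. ((\<lambda>n. F n i) \<longlongrightarrow> L i) G"
proof -
  define K where "K = PiE UNIV (\<lambda>i. cball (0::complex) (c i))"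
  have "compactin (product_topology (\<lambda>_. euclidean) UNIV) K"
    unfolding K_def compactin_PiE by simp
  then have K: "compact K" by (simp add: euclidean_product_topology)
  have "eventually (\<lambda>f. f \<in> K) (filtermap F sequentially)"
    using assms by (simp add: K_def PiE_UNIV_domain eventually_filtermap)
  then obtain L where L: "inf (nhds L) (filtermap F sequentially) \<noteq> bot"
    using K unfolding compact_filter
    by (elim allE[of _ "filtermap F sequentially"] impE bexE) (simp_all add: filtermap_bot_iff)
  \<comment> \<open>The filter generated by the index sets where the sequence is close to its cluster point
    plays the part of a convergent subnet.\<close>
  define G where "G = inf sequentially (filtercomap F (nhds L))"
  have "G \<noteq> bot"
  proof
    assume "G = bot"
    then have "eventually (\<lambda>_. False) G" by simp
    then obtain P P' where P: "eventually P sequentially"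
      and P': "eventually P' (filtercomap F (nhds L))" and PP': "\<forall>n. \<not> (P n \<and> P' n)"
      unfolding G_def eventually_inf by (elim exE conjE) simp
    obtain Q where Q: "eventually Q (nhds L)" and QP': "\<forall>n. Q (F n) \<longrightarrow> P' n"
      using P' unfolding eventually_filtercomap by (elim exE conjE)
    have "eventually (\<lambda>f. \<not> Q f) (filtermap F sequentially)"
      unfolding eventually_filtermap using P by (rule eventually_mono) (use PP' QP' in blast)
    then have "eventually (\<lambda>_. False) (inf (nhds L) (filtermap F sequentially))"
      using Q unfolding eventually_inf by (intro exI[of _ Q] exI[of _ "\<lambda>f. \<not> Q f"]) simp
    then show False using L by (simp add: trivial_limit_def)
  qed
  moreover have "G \<le> sequentially" by (simp add: G_def)
  moreover have "((\<lambda>n. F n i) \<longlongrightarrow> L i) G" for i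
  proof -
    have "filterlim F (nhds L) (filtercomap F (nhds L))" by (rule filterlim_filtercomap)
    then have "(F \<longlongrightarrow> L) G" by (rule filterlim_mono) (simp_all add: G_def)
    with continuous_on_product_coordinates[of i] show ?thesis
      by (rule continuous_on_tendsto_compose) simp_all
  qed
  ultimately show ?thesis by (intro that[of G L]) simp_all
qed

text \<open>
  Balls of operators are compact in the weak operator topology: an operator is determined by its
  matrix coefficients, and by Riesz representation every pointwise limit of uniformly bounded
  matrix coefficients again comes from a bounded operator.
\<close>

lemma bounded_ops_weak_cluster_point:
  fixes Y :: "nat \<Rightarrow> 'a::chilbert_space \<Rightarrow> 'a"
  assumes S: "csubspace S" "closed S"
    and Y: "\<And>n. bounded_op S S (Y n)"
    and bound: "\<And>n v. v \<in> S \<Longrightarrow> norm (Y n v) \<le> K * norm v" and "K \<ge> 0"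
  obtains G Z where "G \<noteq> bot" "G \<le> sequentially" "bounded_op S S Z"
    "\<forall>u. \<forall>v\<in>S. ((\<lambda>n. cinner u (Y n v)) \<longlongrightarrow> cinner u (Z v)) G"
proof -
  note SD = csubspaceD[OF S(1)]
  \<comment> \<open>Outside the domain nothing is known about the operators, so the forms are cut off there.\<close>
  define F where "F n p = (if snd p \<in> S then cinner (fst p) (Y n (snd p)) else 0)"
    for n and p :: "'a \<times> 'a"
  have F_le: "cmod (F n (u, v)) \<le> K * norm u * norm v" for n u v
  proof (cases "v \<in> S")
    case True
    have "cmod (cinner u (Y n v)) \<le> norm u * norm (Y n v)" by (rule norm_cinner_le)
    also have "\<dots> \<le> norm u * (K * norm v)"
      using True by (intro mult_left_mono bound) simp_all
    finally show ?thesis using True by (simp add: F_def mult_ac)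
  qed (simp add: F_def \<open>K \<ge> 0\<close>)
  obtain G L where G: "G \<noteq> bot" "G \<le> sequentially"
    and lim: "\<forall>p. ((\<lambda>n. F n p) \<longlongrightarrow> L p) G"
  proof (rule bounded_family_cluster_point[where F = F])
    show "cmod (F n p) \<le> K * norm (fst p) * norm (snd p)" for n p
      using F_le[of n "fst p" "snd p"] by simp
  qed
  have limS: "((\<lambda>n. cinner u (Y n v)) \<longlongrightarrow> L (u, v)) G" if "v \<in> S" for u v
    using lim[rule_format, of "(u, v)"] that by (simp add: F_def)
  note unique = tendsto_unique[OF G(1)]
  have L_le: "cmod (L (u, v)) \<le> K * norm u * norm v" for u v
    by (rule tendsto_upperbound[OF tendsto_norm[OF lim[rule_format]] _ G(1)])
      (intro always_eventually allI F_le)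
  have Riesz: "\<exists>z\<in>S. \<forall>u\<in>S. L (u, v) = cinner u z" if v: "v \<in> S" for v
  proof (rule Riesz_representation[OF S, where K = "K * norm v"])
    show "L (u + u', v) = L (u, v) + L (u', v)" for u u'
      by (rule unique[OF limS[OF v]], unfold cinner_add_left)
        (intro tendsto_add limS v)
    show "L (c *\<^sub>C u, v) = c * L (u, v)" for c u
      by (rule unique[OF limS[OF v]], unfold cinner_scaleC_left)
        (intro tendsto_mult_left limS v)
    show "cmod (L (u, v)) \<le> K * norm v * norm u" for u
      using L_le[of u v] by (simp add: mult_ac)
  qed
  define Z where "Z v = (SOME z. z \<in> S \<and> (\<forall>u\<in>S. L (u, v) = cinner u z))" for v
  have Z_spec: "Z v \<in> S \<and> (\<forall>u\<in>S. L (u, v) = cinner u (Z v))" if "v \<in> S" for v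
    unfolding Z_def using Riesz[OF that] unfolding Bex_def by (rule someI_ex)
  then have ZS: "Z v \<in> S" if "v \<in> S" for v
    using that by simp
  have Z: "L (u, v) = cinner u (Z v)" if "u \<in> S" "v \<in> S" for u v
    using Z_spec[OF that(2)] that(1) by simp
  have conv: "((\<lambda>n. cinner u (Y n v)) \<longlongrightarrow> cinner u (Z v)) G" if v: "v \<in> S" for u v
  proof -
    \<comment> \<open>The adjoint of the inclusion of the subspace is the orthogonal projection onto it.\<close>
    define p where "p = adjoint_on S (\<lambda>w. w) u"
    note adj = adjoint_on[OF S bounded_op_ident]
    have p: "cinner u w = cinner p w" if "w \<in> S" for w
      using adj(2)[OF that, of u] cinner_commute[of u w] cinner_commute[of p w]
      by (simp add: p_def)
    have "((\<lambda>n. cinner p (Y n v)) \<longlongrightarrow> cinner p (Z v)) G"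
      using limS[OF v, of p] Z[of p v] adj(1)[of u] v by (simp add: p_def)
    then show ?thesis
      using v by (simp add: p ZS bounded_opD(1)[OF Y])
  qed
  have "bounded_op S S Z"
  proof (rule bounded_opI[where K = K])
    fix v assume v: "v \<in> S"
    show "Z v \<in> S" by (rule ZS[OF v])
    have "norm (Z v) * norm (Z v) = cmod (L (Z v, v))"
      unfolding Z[OF ZS[OF v] v] cinner_self by (simp add: norm_power power2_eq_square norm_mult)
    also have "\<dots> \<le> norm (Z v) * (K * norm v)"
      using L_le[of "Z v" v] by (simp add: mult_ac)
    finally show "norm (Z v) \<le> K * norm v"
      using \<open>K \<ge> 0\<close> by (cases "norm (Z v) = 0") (auto simp: mult_le_cancel_left)
    show "Z (c *\<^sub>C v) = c *\<^sub>C Z v" for c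
    proof (rule adjoint_unique[OF S(1)])
      fix u assume "u \<in> S"
      show "cinner u (Z (c *\<^sub>C v)) = cinner u (c *\<^sub>C Z v)"
        by (rule unique[OF conv[OF SD(3)[OF v]]],
            unfold cinner_scaleC_right bounded_opD(3)[OF Y v])
          (intro tendsto_mult_left conv v)
    qed (simp_all add: SD ZS v)
    fix w assume w: "w \<in> S"
    show "Z (v + w) = Z v + Z w"
    proof (rule adjoint_unique[OF S(1)])
      fix u assume "u \<in> S"
      show "cinner u (Z (v + w)) = cinner u (Z v + Z w)"
        by (rule unique[OF conv[OF SD(2)[OF v w]]],
            unfold cinner_add_right bounded_opD(2)[OF Y v w])
          (intro tendsto_add conv v w)
    qed (simp_all add: SD ZS v w)
  qed
  then show ?thesis using G conv by (intro that[of G Z]) simp_all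
qed

lemma antihermitian_weak_limit:
  fixes Y :: "'i \<Rightarrow> 'a::chilbert_space \<Rightarrow> 'a"
  assumes S: "csubspace S" "closed S" and "G \<noteq> bot"
    and Y: "\<And>n. antihermitian_on S (Y n)" and Z: "bounded_op S S Z"
    and conv: "\<And>u v. v \<in> S \<Longrightarrow> ((\<lambda>n. cinner u (Y n v)) \<longlongrightarrow> cinner u (Z v)) G"
  shows "antihermitian_on S Z"
  unfolding antihermitian_on_iff[OF S]
proof (intro conjI ballI Z)
  fix u v assume u: "u \<in> S" and v: "v \<in> S"
  have "cinner u (Y n v) = - cnj (cinner v (Y n u))" for n
    using Y[of n] u v unfolding antihermitian_on_iff[OF S]
    by (metis cinner_commute minus_minus)
  then have "((\<lambda>n. cinner u (Y n v)) \<longlongrightarrow> - cnj (cinner v (Z u))) G"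
    using tendsto_minus[OF tendsto_cnj[OF conv[OF u, of v]]] by simp
  then have "cinner u (Z v) = - cnj (cinner v (Z u))"
    using conv[OF v, of u] by (rule tendsto_unique[OF \<open>G \<noteq> bot\<close>, rotated])
  then show "cinner (Z u) v = - cinner u (Z v)"
    using cinner_commute[of "Z u" v] by simp
qed

section \<open>Minimal norm\<close>

text \<open>
  Since \<open>B\<close> fixes the vectors of \<open>S\<close>, the norm of \<open>R + Y B\<close> controls the norm of \<open>Y\<close>. This
  coercivity keeps a minimising sequence bounded, and the weak limit of such a sequence along a
  suitable filter is a minimiser.
\<close>

theorem antihermitian_perturbation_minimizer:
  fixes R B :: "'a::chilbert_space \<Rightarrow> 'a"
  assumes S: "csubspace S" "closed S"
    and R: "bounded_op UNIV UNIV R" and B: "bounded_op UNIV S B"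
    and B_id: "\<And>s. s \<in> S \<Longrightarrow> B s = s"
  shows "\<exists>Y0. antihermitian_on S Y0 \<and> (\<forall>Y. antihermitian_on S Y \<longrightarrow>
    onorm (\<lambda>h. R h + Y0 (B h)) \<le> onorm (\<lambda>h. R h + Y (B h)))"
proof -
  define N where "N Y = onorm (\<lambda>h. R h + Y (B h))" for Y
  have lin: "bounded_linear (\<lambda>h. R h + Y (B h))" if "antihermitian_on S Y" for Y
  proof (intro bounded_op_imp_bounded_linear bounded_op_add R)
    show "bounded_op UNIV UNIV (\<lambda>h. Y (B h))"
      using bounded_op_compose[OF B] bounded_op_mono that subset_UNIV
      unfolding antihermitian_on_def by blast
  qed
  have N_bound: "norm (R h + Y (B h)) \<le> N Y * norm h" if "antihermitian_on S Y" for Y h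
    unfolding N_def using onorm[OF lin[OF that]] .
  define m where "m = Inf (N ` {Y. antihermitian_on S Y})"
  have bdd: "bdd_below (N ` {Y. antihermitian_on S Y})"
    unfolding N_def using onorm_pos_le[OF lin] by (intro bdd_belowI2[where m = 0]) auto
  have m_le: "m \<le> N Y" if "antihermitian_on S Y" for Y
    unfolding m_def using bdd that by (auto intro: cINF_lower)
  have "antihermitian_on S (\<lambda>_. 0)"
    using csubspaceD(1)[OF S(1)] by (simp add: antihermitian_on_iff[OF S] bounded_op_zero)
  then have ne: "N ` {Y. antihermitian_on S Y} \<noteq> {}" by blast
  have "\<exists>Y. antihermitian_on S Y \<and> N Y < m + 1 / real (Suc n)" for n
    using cInf_less_iff[OF ne bdd, of "m + 1 / real (Suc n)"] by (auto simp: m_def)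
  then obtain Y where Y: "\<And>n. antihermitian_on S (Y n)"
    and NY: "\<And>n. N (Y n) < m + 1 / real (Suc n)"
    by metis
  obtain C where C: "C \<ge> 0" "\<And>h. norm (R h) \<le> C * norm h"
    using bounded_op_bound[OF R] by blast
  have m0: "m \<ge> 0"
    unfolding m_def N_def using ne onorm_pos_le[OF lin] unfolding N_def by (intro cINF_greatest) auto
  have Y_bound: "norm (Y n s) \<le> (m + 1 + C) * norm s" if s: "s \<in> S" for n s
  proof -
    have "N (Y n) \<le> m + 1"
      using NY[of n] by (rule order.trans[OF less_imp_le]) simp
    have "norm (Y n s) \<le> norm (R s + Y n (B s)) + norm (R s)"
      using norm_triangle_ineq4[of "R s + Y n (B s)" "R s"] B_id[OF s] by simp
    also have "\<dots> \<le> N (Y n) * norm s + C * norm s"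
      by (intro add_mono N_bound Y C)
    also have "\<dots> \<le> (m + 1 + C) * norm s"
      using mult_right_mono[OF \<open>N (Y n) \<le> m + 1\<close> norm_ge_zero[of s]] by (simp add: algebra_simps)
    finally show ?thesis .
  qed
  obtain G Y0 where G: "G \<noteq> bot" "G \<le> sequentially" and Y0: "bounded_op S S Y0"
    and conv: "\<forall>u. \<forall>v\<in>S. ((\<lambda>n. cinner u (Y n v)) \<longlongrightarrow> cinner u (Y0 v)) G"
  proof (rule bounded_ops_weak_cluster_point[where Y = Y, OF S _ Y_bound])
    show "bounded_op S S (Y n)" for n using Y unfolding antihermitian_on_def by blast
    show "m + 1 + C \<ge> 0" using m0 C(1) by simp
  qed
  have anti: "antihermitian_on S Y0"
    by (rule antihermitian_weak_limit[OF S G(1) Y Y0 conv[rule_format]])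
  have "norm (R h + Y0 (B h)) \<le> m * norm h" for h
  proof -
    \<comment> \<open>Lower semicontinuity: the norm of the limit vector is read off by testing the convergent
      sequence against the limit vector itself.\<close>
    define g where "g = R h + Y0 (B h)"
    have "((\<lambda>n. cinner g (R h + Y n (B h))) \<longlongrightarrow> cinner g g) G"
      unfolding g_def[THEN arg_cong[where f = "cinner g"]] cinner_add_right
      by (intro tendsto_intros conv[rule_format] bounded_opD(1)[OF B]) simp
    then have lhs: "((\<lambda>n. cmod (cinner g (R h + Y n (B h)))) \<longlongrightarrow> cmod (cinner g g)) G"
      by (rule tendsto_norm)
    have "(\<lambda>n. norm g * ((m + 1 / real (Suc n)) * norm h)) \<longlonglongrightarrow> norm g * ((m + 0) * norm h)"
      using LIMSEQ_inverse_real_of_nat by (intro tendsto_intros) (simp add: inverse_eq_divide)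
    then have rhs: "((\<lambda>n. norm g * ((m + 1 / real (Suc n)) * norm h))
        \<longlongrightarrow> norm g * ((m + 0) * norm h)) G"
      by (rule tendsto_mono[OF G(2)])
    have "cmod (cinner g (R h + Y n (B h))) \<le> norm g * ((m + 1 / real (Suc n)) * norm h)" for n
    proof -
      have "norm (R h + Y n (B h)) \<le> (m + 1 / real (Suc n)) * norm h"
        using N_bound[OF Y, of h n] mult_right_mono[OF less_imp_le[OF NY[of n]] norm_ge_zero[of h]]
        by linarith
      then show ?thesis
        by (rule order.trans[OF norm_cinner_le mult_left_mono]) simp
    qed
    then have "cmod (cinner g g) \<le> norm g * ((m + 0) * norm h)"
      by (intro tendsto_le[OF G(1) rhs lhs] always_eventually) blast
    then have "norm g * norm g \<le> norm g * (m * norm h)"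
      by (simp add: cinner_self norm_power power2_eq_square norm_mult)
    then show ?thesis
      using m0 by (cases "norm g = 0") (auto simp: mult_le_cancel_left simp flip: g_def)
  qed
  then have "N Y0 \<le> m" unfolding N_def using m0 by (intro onorm_bound) auto
  then have "N Y0 \<le> N Y" if "antihermitian_on S Y" for Y
    using m_le[OF that] by linarith
  with anti show ?thesis unfolding N_def by (intro exI[of _ Y0] conjI allI impI)
qed

section \<open>The row operator\<close>

theorem proposition4p3:
  fixes P0 :: "'a::chilbert_space \<Rightarrow> 'a" and f0 :: 'a and x0 :: real
    and x A :: "'a \<Rightarrow> 'a"
  assumes "(P0, f0) \<in> proj_vec_pairs"
    and "bounded_op (range P0 \<ominus> cline f0) (cline f0) x"
    and "bounded_op (nullspace P0) (range P0) A"
  shows "\<exists>Y0. antihermitian_on (range P0 \<ominus> cline f0) Y0 \<and>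
    (\<forall>Y. antihermitian_on (range P0 \<ominus> cline f0) Y \<longrightarrow>
      onorm (row_operator P0 f0 x0 x Y0 A) \<le> onorm (row_operator P0 f0 x0 x Y A))"
proof -
  define S where "S = range P0 \<ominus> cline f0"
  have P: "bounded_op UNIV UNIV P0" and PP: "P0 (P0 h) = P0 h" and Pf: "P0 f0 = f0"
    and f: "norm f0 = 1" for h
    using assms(1) by (auto simp: proj_vec_pairs_def orthogonal_projection_def fun_eq_iff)
  have ff: "cinner f0 f0 = 1" by (simp add: cinner_self f)
  define B where "B h = P0 h - cinner (P0 h) f0 *\<^sub>C f0" for h
  have S_iff: "u \<in> S \<longleftrightarrow> P0 u = u \<and> cinner u f0 = 0" for u
  proof -
    have "u \<in> range P0 \<longleftrightarrow> P0 u = u" using PP by (metis rangeE rangeI)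
    moreover have "(\<forall>y\<in>cline f0. cinner u y = 0) \<longleftrightarrow> cinner u f0 = 0"
      unfolding cline_def by (auto simp: cinner_scaleC_right dest: spec[of _ 1])
    ultimately show ?thesis by (simp add: S_def ortho_minus_def)
  qed
  have coef: "bounded_op UNIV UNIV (\<lambda>h. cinner (P0 h) f0 *\<^sub>C f0)"
    using bounded_op_compose[OF P bounded_op_cinner_scaleC] .
  have B_UNIV: "bounded_op UNIV UNIV B"
    unfolding B_def by (intro bounded_op_diff P coef)
  have B_id: "B s = s" if "s \<in> S" for s
    using that by (simp add: B_def S_iff)
  have B_in: "B h \<in> S" for h
  proof -
    have "B h = P0 (h - cinner (P0 h) f0 *\<^sub>C f0)"
      using bounded_linear.linear[OF bounded_op_imp_bounded_linear[OF P]]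
      by (simp add: B_def linear_diff bounded_opD(3)[OF P] Pf)
    then have "P0 (B h) = B h" by (simp only: PP)
    moreover have "cinner (B h) f0 = 0"
      by (simp add: B_def cinner_diff_left cinner_scaleC_left ff)
    ultimately show ?thesis by (simp add: S_iff)
  qed
  then have B: "bounded_op UNIV S B"
    using B_UNIV unfolding bounded_op_def by blast
  have S_sub: "csubspace S"
    unfolding csubspace_def
    using bounded_opD(3)[OF P, of 0 0]
    by (auto simp: S_iff bounded_opD[OF P] cinner_add_left cinner_scaleC_left)
  have S_eq: "S = {h. B h = h}" using B_id by (auto, metis B_in)
  have S_closed: "closed S"
    unfolding S_eq
    by (intro closed_Collect_eq continuous_on_id
        linear_continuous_on[OF bounded_op_imp_bounded_linear[OF B_UNIV]])
  have x: "bounded_op S UNIV x"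
    using bounded_op_mono[OF assms(2) subset_UNIV] by (simp add: S_def)
  have A: "bounded_op (nullspace P0) UNIV A"
    using bounded_op_mono[OF assms(3) subset_UNIV] .
  have Pn: "bounded_op UNIV (nullspace P0) (\<lambda>h. h - P0 h)"
  proof -
    have "P0 (h - P0 h) = 0" for h
      using bounded_linear.linear[OF bounded_op_imp_bounded_linear[OF P]]
      by (simp add: linear_diff PP)
    then show ?thesis
      using bounded_op_diff[OF bounded_op_ident P] by (simp add: bounded_op_def nullspace_def)
  qed
  define R where "R = row_operator P0 f0 x0 x (\<lambda>_. 0) A"
  have R_eq: "R = (\<lambda>h. (\<i> * complex_of_real x0) *\<^sub>C (cinner (P0 h) f0 *\<^sub>C f0) + x (B h)
      + - adjoint_on S x (cinner (P0 h) f0 *\<^sub>C f0) + A (h - P0 h))"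
    by (simp add: fun_eq_iff R_def row_operator_def B_def S_def Let_def)
  have "bounded_op UNIV UNIV R"
    unfolding R_eq
    by (intro bounded_op_add bounded_op_scaleC bounded_op_minus coef
        bounded_op_compose[OF B x] bounded_op_compose[OF Pn A] bounded_op_compose[OF coef]
        bounded_op_mono[OF bounded_op_adjoint_on[OF S_sub S_closed x] subset_UNIV])
  note minimizer = antihermitian_perturbation_minimizer[OF S_sub S_closed this B B_id]
  have "row_operator P0 f0 x0 x Y A = (\<lambda>h. R h + Y (B h))" for Y
    by (simp add: fun_eq_iff R_def row_operator_def B_def Let_def)
  with minimizer show ?thesis by (simp only: flip: S_def)
qed

end
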